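(* Let $N\ge 2$ and $r$ be integers with $1\le r\le \lfloor N/2\rfloor$, and let $A\subset\mathbb{Z}/N\mathbb{Z}$. Define $f_A(n)=\mathbf{1}_A(n)-\frac{|A|}{N}$ for $n\in\mathbb{Z}/N\mathbb{Z}$, and $g_A=f_A*F_r$. Then for all $n\in\mathbb{Z}/N\mathbb{Z}$, $$|g_A(n)|=\Bigl|\sum_{m\in\mathbb{Z}/N\mathbb{Z}}\Bigl(\mathbf{1}_A(n-m)-\frac{|A|}{N}\Bigr)F_r(m)\Bigr|\;\le\;\sqrt{\tfrac{5}{3}}\;r^{-1/2}\,\|f_A\|_2\;\le\;\sqrt{\tfrac{5}{12}}\;r^{-1/2}N^{1/2}.$$ Equivalently, there is an absolute constant $C>0$ (independent of $N$, $r$, $A$ and $n$) such that for all such $N,r,A$ and all $n\in\mathbb{Z}/N\mathbb{Z}$, $$\Bigl|\sum_{m\in\mathbb{Z}/N\mathbb{Z}}\mathbf{1}_A(n-m)F_r(m)-\frac{|A|}{N}\Bigr|\le C\,r^{-1/2}N^{1/2}.$$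
   Context: For $n\in\mathbb{Z}/N\mathbb{Z}$, $|n|$ denotes the absolute value of a representative of $n$ of least absolute value in $\{-\lfloor N/2\rfloor,\dots,\lfloor N/2\rfloor\}$; for a set $A$, $|A|$ is its cardinality and $\mathbf{1}_A$ its indicator function. For integers $N\ge 2$ and $1\le r\le\lfloor N/2\rfloor$, the triangular kernel $F_r:\mathbb{Z}/N\mathbb{Z}\to[0,\infty)$ is $$F_r(n)=\frac1r\max\Bigl(0,\,1-\frac{|n|}{r}\Bigr).$$ For $f,g:\mathbb{Z}/N\mathbb{Z}\to\mathbb{C}$ the (circular, unnormalized) convolution is $(f*g)(n)=\sum_{m\in\mathbb{Z}/N\mathbb{Z}}f(n-m)g(m)$, and $\|f\|_2=\bigl(\sum_{n\in\mathbb{Z}/N\mathbb{Z}}|f(n)|^2\bigr)^{1/2}$. *)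

theory Defs
  imports
    "HOL-Number_Theory.Residues"
    "HOL-Analysis.L2_Norm"
    "HOL-Library.Indicator_Function"
begin

text \<open>
  \<open>\<int>/N\<int>\<close> is \<^const>\<open>residue_ring\<close> \<open>N\<close>, with carrier \<open>{0..N - 1}\<close>. Functions on
  \<open>\<int>/N\<int>\<close> are functions on \<^typ>\<open>int\<close> of which only the values on this carrier matter.
\<close>

text \<open>
  For even \<open>N\<close> the class of \<open>N div 2\<close> has the two representatives \<open>\<plusminus>(N div 2)\<close> in the range;
  in all other cases (with \<open>N \<ge> 1\<close>) the set below comes from a single representative.
\<close>
definition res_abs :: "int \<Rightarrow> int \<Rightarrow> int" where
  "res_abs N n = Min {\<bar>k\<bar> | k. k \<in> {- (N div 2)..N div 2} \<and> [k = n] (mod N)}"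

definition triangular_kernel :: "int \<Rightarrow> int \<Rightarrow> int \<Rightarrow> real" where
  "triangular_kernel N r n =
     1 / real_of_int r * max 0 (1 - real_of_int (res_abs N n) / real_of_int r)"

definition circ_conv :: "int \<Rightarrow> (int \<Rightarrow> complex) \<Rightarrow> (int \<Rightarrow> complex) \<Rightarrow> int \<Rightarrow> complex" where
  "circ_conv N f g n =
     (\<Sum>m\<in>carrier (residue_ring N). f (n \<ominus>\<^bsub>residue_ring N\<^esub> m) * g m)"

definition norm2 :: "int \<Rightarrow> (int \<Rightarrow> complex) \<Rightarrow> real" where
  "norm2 N f = L2_set (\<lambda>n. cmod (f n)) (carrier (residue_ring N))"

definition balanced_fun :: "int \<Rightarrow> int set \<Rightarrow> int \<Rightarrow> complex" where
  "balanced_fun N A n = indicator A n - of_nat (card A) / of_int N"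

definition smoothed_fun :: "int \<Rightarrow> int \<Rightarrow> int set \<Rightarrow> int \<Rightarrow> complex" where
  "smoothed_fun N r A =
     circ_conv N (balanced_fun N A) (\<lambda>m. complex_of_real (triangular_kernel N r m))"

end

theory Submission imports Defs begin

text \<open>
  The case \<open>p = q = 2\<close> of Young's inequality, \<open>\<bar>(f * g)(n)\<bar> \<le> \<parallel>f\<parallel>\<^sub>2 \<parallel>g\<parallel>\<^sub>2\<close>, is the Cauchy--Schwarz
  inequality together with the fact that \<open>m \<mapsto> n - m\<close> permutes \<open>\<int>/N\<int>\<close>
  (\<open>cmod_circ_conv_le\<close>). Applied to \<open>f\<^sub>A * F\<^sub>r\<close> it leaves two norms to estimate.

  Since \<open>2r \<le> N\<close>, the points \<open>-r < k < r\<close> are distinct modulo \<open>N\<close>, so the triangle does not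
  overlap itself, and a sum over \<open>\<int>/N\<int>\<close> of a function of \<open>\<bar>m\<bar>\<close> that vanishes from \<open>r\<close> on is
  its central value plus twice one flank (\<open>sum_res_abs_eq\<close>). At distance \<open>i\<close> from the end of
  its support the kernel has the value \<open>i / r\<^sup>2\<close>, so that power sums give
  \<open>\<parallel>F\<^sub>r\<parallel>\<^sub>2\<^sup>2 = (2 r\<^sup>2 + 1) / (3 r\<^sup>3) \<le> 1 / r\<close>, which is stronger than the bound \<open>5 / (3 r)\<close> needed,
  and also \<open>\<Sum> F\<^sub>r = 1\<close>. On the other side, \<open>\<parallel>f\<^sub>A\<parallel>\<^sub>2\<^sup>2 = \<bar>A\<bar> (1 - \<bar>A\<bar> / N) \<le> N / 4\<close> is \<open>N\<close> times a
  Bernoulli variance.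

  As the kernel has mass one, convolving the constant \<open>\<bar>A\<bar> / N\<close> with it returns
  \<open>\<bar>A\<bar> / N\<close>, so the quantity in the second formulation is \<open>g\<^sub>A(n)\<close> itself and \<open>C = \<surd>(5/12)\<close> works.
\<close>

section \<open>Convolution on the residue ring\<close>

lemma residue_ring_minus_eq:
  assumes "2 \<le> N" and n: "n \<in> carrier (residue_ring N)" and m: "m \<in> carrier (residue_ring N)"
  shows "n \<ominus>\<^bsub>residue_ring N\<^esub> m = (n - m) mod N"
proof -
  interpret residues N "residue_ring N" by unfold_locales (use assms in auto)
  show ?thesis
    by (simp add: a_minus_def res_neg_eq res_add_eq mod_simps)
qed

lemma bij_betw_residue_ring_minus:
  assumes "2 \<le> N" "n \<in> carrier (residue_ring N)"
  shows "bij_betw (\<lambda>m. n \<ominus>\<^bsub>residue_ring N\<^esub> m) (carrier (residue_ring N)) (carrier (residue_ring N))"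
proof -
  \<comment> \<open>The map is its own inverse.\<close>
  have "bij_betw (\<lambda>m. (n - m) mod N) {0..N-1} {0..N-1}"
    by (rule bij_betw_byWitness[where f' = "\<lambda>m. (n - m) mod N"])
       (use assms in \<open>auto simp: mod_simps\<close>)
  then have "bij_betw (\<lambda>m. (n - m) mod N) (carrier (residue_ring N)) (carrier (residue_ring N))"
    by (simp add: residue_ring_def)
  then show ?thesis
    by (subst bij_betw_cong[OF residue_ring_minus_eq[OF assms]])
qed

lemma cmod_circ_conv_le:
  assumes "2 \<le> N" "n \<in> carrier (residue_ring N)"
  shows "cmod (circ_conv N f g n) \<le> norm2 N f * norm2 N g"
proof -
  let ?R = "carrier (residue_ring N)"
  let ?h = "\<lambda>m. f (n \<ominus>\<^bsub>residue_ring N\<^esub> m)"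
  have "cmod (circ_conv N f g n) \<le> (\<Sum>m\<in>?R. \<bar>cmod (?h m)\<bar> * \<bar>cmod (g m)\<bar>)"
    unfolding circ_conv_def by (rule order.trans[OF norm_sum]) (simp add: norm_mult)
  also have "\<dots> \<le> L2_set (\<lambda>m. cmod (?h m)) ?R * norm2 N g"
    unfolding norm2_def by (rule L2_set_mult_ineq)
  also have "L2_set (\<lambda>m. cmod (?h m)) ?R = norm2 N f"
    unfolding norm2_def L2_set_def
    using sum.reindex_bij_betw[OF bij_betw_residue_ring_minus[OF assms],
        of "\<lambda>k. (cmod (f k))\<^sup>2"] by simp
  finally show ?thesis .
qed

section \<open>Mass and energy of the triangular kernel\<close>

text \<open>
  A representative in \<open>[-N/2, N/2]\<close> can only be \<open>m\<close> or \<open>m - N\<close>. If \<open>N\<close> is even and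
  \<open>m = N / 2\<close> both lie in the range, but they have the same absolute value.
\<close>
lemma res_abs_eq:
  assumes "2 \<le> N" "0 \<le> m" "m < N"
  shows "res_abs N m = min m (N - m)"
proof -
  let ?S = "{\<bar>k\<bar> | k. k \<in> {- (N div 2)..N div 2} \<and> [k = m] (mod N)}"
  have fin: "finite ?S"
    by (rule finite_subset[of _ "{0..N}"]) (use assms in auto)
  have cases: "k = m \<or> k = m - N"
    if k: "- (N div 2) \<le> k" "k \<le> N div 2" "[k = m] (mod N)" for k
  proof (cases "0 \<le> k")
    case True
    then have "k mod N = k" using k assms by (intro mod_pos_pos_trivial) auto
    then show ?thesis using k assms by (simp add: cong_def)
  next
    case False
    then have "(k + N) mod N = k + N" using k assms by (intro mod_pos_pos_trivial) linarith+
    then show ?thesis using k assms by (simp add: cong_def)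
  qed
  have mem: "min m (N - m) \<in> ?S"
  proof (cases "m \<le> N div 2")
    case True
    then have "min m (N - m) = \<bar>m\<bar>" using assms by linarith
    then show ?thesis using True assms by (intro CollectI exI[of _ m]) auto
  next
    case False
    then have "min m (N - m) = \<bar>m - N\<bar>" using assms by linarith
    then show ?thesis using False assms
      by (intro CollectI exI[of _ "m - N"]) (auto simp: cong_def)
  qed
  have low: "min m (N - m) \<le> s" if "s \<in> ?S" for s
    using that cases assms by fastforce
  show ?thesis
    unfolding res_abs_def using Min_eqI[OF fin low mem] .
qed

text \<open>
  Residues below \<open>r\<close> form the right half of the support and residues above \<open>N - r\<close> the left half;
  \<open>2r \<le> N\<close> keeps them apart. The flank is indexed by the distance \<open>i\<close> to the end of the support,
  on which the triangular kernel depends linearly.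
\<close>
lemma sum_res_abs_eq:
  fixes G :: "int \<Rightarrow> real" and r :: nat
  assumes N: "2 \<le> N" and r: "1 \<le> r" "int r \<le> N div 2"
    and G: "\<And>j. int r \<le> j \<Longrightarrow> G j = 0"
  shows "(\<Sum>m\<in>carrier (residue_ring N). G (res_abs N m)) =
         G 0 + 2 * (\<Sum>i=1..<r. G (int r - int i))"
proof -
  let ?h = "\<lambda>m. G (min m (N - m))"
  have "(\<Sum>m\<in>carrier (residue_ring N). G (res_abs N m)) = (\<Sum>m\<in>{0..N-1}. ?h m)"
    by (rule sum.cong) (use N in \<open>auto simp: residue_ring_def res_abs_eq\<close>)
  also have "\<dots> = (\<Sum>m\<in>{0} \<union> ({1..int r - 1} \<union> {N - int r + 1..N - 1}). ?h m)"
    by (rule sum.mono_neutral_right) (use N r in \<open>auto intro!: G\<close>)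
  also have "\<dots> = (\<Sum>m\<in>{0}. ?h m) + ((\<Sum>m\<in>{1..int r - 1}. ?h m) + (\<Sum>m\<in>{N - int r + 1..N - 1}. ?h m))"
    using N r by (subst sum.union_disjoint; (subst sum.union_disjoint)?) auto
  also have "(\<Sum>m\<in>{1..int r - 1}. ?h m) = (\<Sum>i=1..<r. G (int r - int i))"
    by (rule sum.reindex_bij_witness[of _ "\<lambda>i. int r - int i" "\<lambda>m. nat (int r - m)"])
       (use N r in \<open>auto simp: min_def\<close>)
  also have "(\<Sum>m\<in>{N - int r + 1..N - 1}. ?h m) = (\<Sum>i=1..<r. G (int r - int i))"
    by (rule sum.reindex_bij_witness[of _ "\<lambda>i. N - int r + int i" "\<lambda>m. nat (m - N + int r)"])
       (use N r in \<open>auto simp: min_def\<close>)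
  finally show ?thesis using N by simp
qed

lemma sum_id_below: "(\<Sum>i=1..<k. real i) = (real k - 1) * real k / 2"
  by (induction k) (auto simp: field_simps)

lemma sum_squares_below:
  "(\<Sum>i=1..<k. (real i)\<^sup>2) = (real k - 1) * real k * (2 * real k - 1) / 6"
  by (induction k) (auto simp: field_simps power2_eq_square)

context
  fixes N r :: int
  assumes N: "2 \<le> N" and r: "1 \<le> r" "r \<le> N div 2"
begin

lemma sum_triangular_kernel:
  "(\<Sum>m\<in>carrier (residue_ring N). triangular_kernel N r m) = 1"
proof -
  define k where "k = nat r"
  have k: "r = int k" "1 \<le> k" using r by (auto simp: k_def)
  let ?c = "real k"
  let ?G = "\<lambda>j. 1 / ?c * max 0 (1 - real_of_int j / ?c)"
  have pos: "0 < ?c" using k by simp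
  have flank: "?G (int (k) - int i) = real i / ?c\<^sup>2" if "i \<in> {1..<k}" for i
    using that pos by (auto simp: field_simps power2_eq_square max_def)
  have "(\<Sum>m\<in>carrier (residue_ring N). triangular_kernel N r m) =
        ?G 0 + 2 * (\<Sum>i=1..<k. ?G (int (k) - int i))"
    unfolding triangular_kernel_def k(1)
    using sum_res_abs_eq[of N "k" ?G] N r k by (auto simp: field_simps)
  also have "(\<Sum>i=1..<k. ?G (int (k) - int i)) = (\<Sum>i=1..<k. real i) / ?c\<^sup>2"
    unfolding sum_divide_distrib by (rule sum.cong[OF refl flank])
  also have "?G 0 + 2 * ((\<Sum>i=1..<k. real i) / ?c\<^sup>2) = 1"
    unfolding sum_id_below using pos by (simp add: field_simps power2_eq_square)
  finally show ?thesis .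
qed

lemma norm2_triangular_kernel_le:
  "norm2 N (\<lambda>m. complex_of_real (triangular_kernel N r m)) \<le> real_of_int r powr (- 1 / 2)"
proof -
  define k where "k = nat r"
  have k: "r = int k" "1 \<le> k" using r by (auto simp: k_def)
  let ?c = "real k"
  let ?G = "\<lambda>j. (1 / ?c * max 0 (1 - real_of_int j / ?c))\<^sup>2"
  have pos: "0 < ?c" using k by simp
  have flank: "?G (int (k) - int i) = (real i)\<^sup>2 / ?c ^ 4" if "i \<in> {1..<k}" for i
    using that pos by (auto simp: field_simps power2_eq_square power4_eq_xxxx max_def)
  have "(\<Sum>m\<in>carrier (residue_ring N). (triangular_kernel N r m)\<^sup>2) =
        ?G 0 + 2 * (\<Sum>i=1..<k. ?G (int (k) - int i))"
    unfolding triangular_kernel_def k(1)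
    using sum_res_abs_eq[of N "k" ?G] N r k by (auto simp: field_simps)
  also have "(\<Sum>i=1..<k. ?G (int (k) - int i)) = (\<Sum>i=1..<k. (real i)\<^sup>2) / ?c ^ 4"
    unfolding sum_divide_distrib by (rule sum.cong[OF refl flank])
  also have "?G 0 + 2 * ((\<Sum>i=1..<k. (real i)\<^sup>2) / ?c ^ 4) = (2 * ?c\<^sup>2 + 1) / (3 * ?c ^ 3)"
    unfolding sum_squares_below
    using pos by (simp add: field_simps power2_eq_square power3_eq_cube power4_eq_xxxx)
  also have "\<dots> \<le> 1 / ?c"
  proof -
    have "1 \<le> ?c * ?c" using k mult_mono[of 1 ?c 1 ?c] by simp
    then show ?thesis
      using pos by (simp add: divide_simps) (simp add: algebra_simps power2_eq_square power3_eq_cube)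
  qed
  finally have "norm2 N (\<lambda>m. complex_of_real (triangular_kernel N r m)) \<le> sqrt (1 / real_of_int r)"
    unfolding norm2_def L2_set_def by (simp add: k)
  also have "\<dots> = real_of_int r powr (- 1 / 2)"
    using r by (simp add: powr_minus powr_half_sqrt real_sqrt_divide field_simps)
  finally show ?thesis .
qed

end

section \<open>Energy of a balanced indicator\<close>

text \<open>
  With density \<open>d\<close> the energy is \<open>N d (1 - d)\<close>; completing the square shows that density
  \<open>1 / 2\<close> is the worst case.
\<close>
lemma norm2_balanced_fun_le:
  assumes N: "1 \<le> N" and A: "A \<subseteq> carrier (residue_ring N)"
  shows "norm2 N (balanced_fun N A) \<le> sqrt (real_of_int N) / 2"
proof -
  let ?R = "carrier (residue_ring N)"
  define a where "a = real (card A)"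
  define d where "d = a / real_of_int N"
  have fin: "finite ?R" and card: "real (card ?R) = real_of_int N"
    using N by (auto simp: residue_ring_def)
  have sumA: "(\<Sum>n\<in>?R. indicator A n :: real) = a"
    using A fin by (simp add: indicator_def sum.If_cases a_def Int_absorb1)
  have pt: "(cmod (balanced_fun N A n))\<^sup>2 = (1 - 2 * d) * indicator A n + d\<^sup>2" for n
  proof -
    have "balanced_fun N A n = complex_of_real (indicator A n - d)"
      by (simp add: balanced_fun_def d_def a_def indicator_def)
    then have "(cmod (balanced_fun N A n))\<^sup>2 = (indicator A n - d)\<^sup>2"
      by (simp only: norm_of_real power2_abs)
    then show ?thesis
      by (simp add: indicator_def power2_eq_square algebra_simps)
  qed
  have "(\<Sum>n\<in>?R. (cmod (balanced_fun N A n))\<^sup>2) = (1 - 2 * d) * a + real_of_int N * d\<^sup>2"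
    unfolding pt by (simp add: sum.distrib sum_distrib_left[symmetric] sumA card)
  also have "\<dots> = real_of_int N / 4 - real_of_int N * (d - 1 / 2)\<^sup>2"
  proof -
    have "a = real_of_int N * d" using N by (simp add: d_def)
    then show ?thesis by (simp add: power2_eq_square algebra_simps)
  qed
  also have "\<dots> \<le> real_of_int N / 4" using N by simp
  finally have "norm2 N (balanced_fun N A) \<le> sqrt (real_of_int N / 4)"
    unfolding norm2_def L2_set_def by simp
  then show ?thesis by (simp add: real_sqrt_divide)
qed

section \<open>Smoothed indicators are nearly constant\<close>

lemma cmod_smoothed_fun_le:
  assumes "2 \<le> N" "1 \<le> r" "r \<le> N div 2" "n \<in> carrier (residue_ring N)"
  shows "cmod (smoothed_fun N r A n)
    \<le> sqrt (5 / 3) * real_of_int r powr (- 1 / 2) * norm2 N (balanced_fun N A)"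
proof -
  let ?q = "real_of_int r powr (- 1 / 2)" and ?b = "norm2 N (balanced_fun N A)"
  have b: "0 \<le> ?b" by (simp add: norm2_def)
  have "cmod (smoothed_fun N r A n) \<le> ?b * ?q"
    unfolding smoothed_fun_def
    by (rule order.trans[OF cmod_circ_conv_le])
       (use assms b norm2_triangular_kernel_le in \<open>auto intro: mult_left_mono\<close>)
  \<comment> \<open>The kernel bound already holds with constant \<open>1\<close>, and \<open>1 \<le> \<surd>(5/3)\<close>.\<close>
  also have "\<dots> \<le> sqrt (5 / 3) * (?b * ?q)"
    using mult_right_mono[of 1 "sqrt (5 / 3)" "?b * ?q"] b by simp
  finally show ?thesis by (simp add: mult_ac)
qed

lemma norm2_balanced_fun_scaled_le:
  assumes "2 \<le> N" "A \<subseteq> carrier (residue_ring N)"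
  shows "sqrt (5 / 3) * real_of_int r powr (- 1 / 2) * norm2 N (balanced_fun N A)
    \<le> sqrt (5 / 12) * real_of_int r powr (- 1 / 2) * real_of_int N powr (1 / 2)"
proof -
  let ?q = "real_of_int r powr (- 1 / 2)"
  have "sqrt (5 / 3) * ?q * norm2 N (balanced_fun N A) \<le> sqrt (5 / 3) * ?q * (sqrt (real_of_int N) / 2)"
    by (intro mult_left_mono norm2_balanced_fun_le) (use assms in auto)
  also have "sqrt (5 / 12) = sqrt (5 / 3) / 2"
    using real_sqrt_divide[of "5 / 3" 4] by simp
  then have "sqrt (5 / 3) * ?q * (sqrt (real_of_int N) / 2) = sqrt (5 / 12) * ?q * real_of_int N powr (1 / 2)"
    using assms by (simp add: powr_half_sqrt)
  finally show ?thesis .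
qed

text \<open>
  Because the kernel has mass one, subtracting the density before or after the convolution
  gives the same function.
\<close>
lemma smoothed_fun_eq:
  assumes "2 \<le> N" "1 \<le> r" "r \<le> N div 2"
  shows "smoothed_fun N r A n = complex_of_real
    ((\<Sum>m\<in>carrier (residue_ring N).
        indicator A (n \<ominus>\<^bsub>residue_ring N\<^esub> m) * triangular_kernel N r m)
      - real (card A) / real_of_int N)"
proof -
  let ?R = "carrier (residue_ring N)" and ?d = "real (card A) / real_of_int N"
  let ?i = "\<lambda>m. indicator A (n \<ominus>\<^bsub>residue_ring N\<^esub> m) :: real"
  have "smoothed_fun N r A n =
      complex_of_real (\<Sum>m\<in>?R. (?i m - ?d) * triangular_kernel N r m)"
    by (auto simp: smoothed_fun_def circ_conv_def balanced_fun_def indicator_def intro!: sum.cong)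
  also have "(\<Sum>m\<in>?R. (?i m - ?d) * triangular_kernel N r m)
      = (\<Sum>m\<in>?R. ?i m * triangular_kernel N r m) - ?d * (\<Sum>m\<in>?R. triangular_kernel N r m)"
    by (simp add: left_diff_distrib sum_subtractf sum_distrib_left)
  finally show ?thesis
    using sum_triangular_kernel[OF assms] by simp
qed

theorem corollary5p2:
  shows "(\<forall>(N::int) (r::int) (A::int set) (n::int).
            2 \<le> N \<longrightarrow> 1 \<le> r \<longrightarrow> r \<le> N div 2 \<longrightarrow>
            A \<subseteq> carrier (residue_ring N) \<longrightarrow> n \<in> carrier (residue_ring N) \<longrightarrow>
              cmod (smoothed_fun N r A n) =
                cmod (\<Sum>m\<in>carrier (residue_ring N).
                  (indicator A (n \<ominus>\<^bsub>residue_ring N\<^esub> m) - of_nat (card A) / of_int N) *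
                  complex_of_real (triangular_kernel N r m))
            \<and> cmod (smoothed_fun N r A n)
                \<le> sqrt (5 / 3) * real_of_int r powr (- 1 / 2) * norm2 N (balanced_fun N A)
            \<and> sqrt (5 / 3) * real_of_int r powr (- 1 / 2) * norm2 N (balanced_fun N A)
                \<le> sqrt (5 / 12) * real_of_int r powr (- 1 / 2) * real_of_int N powr (1 / 2))
       \<and> (\<exists>C::real. C > 0 \<and>
            (\<forall>(N::int) (r::int) (A::int set) (n::int).
              2 \<le> N \<longrightarrow> 1 \<le> r \<longrightarrow> r \<le> N div 2 \<longrightarrow>
              A \<subseteq> carrier (residue_ring N) \<longrightarrow> n \<in> carrier (residue_ring N) \<longrightarrow>
                \<bar>(\<Sum>m\<in>carrier (residue_ring N).
                    indicator A (n \<ominus>\<^bsub>residue_ring N\<^esub> m) * triangular_kernel N r m)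
                  - real (card A) / real_of_int N\<bar>
                \<le> C * real_of_int r powr (- 1 / 2) * real_of_int N powr (1 / 2)))"
proof (intro conjI allI impI)
  fix N r :: int and A :: "int set" and n :: int
  assume h: "2 \<le> N" "1 \<le> r" "r \<le> N div 2" "A \<subseteq> carrier (residue_ring N)"
    "n \<in> carrier (residue_ring N)"
  show "cmod (smoothed_fun N r A n) =
      cmod (\<Sum>m\<in>carrier (residue_ring N).
        (indicator A (n \<ominus>\<^bsub>residue_ring N\<^esub> m) - of_nat (card A) / of_int N) *
        complex_of_real (triangular_kernel N r m))"
    by (simp add: smoothed_fun_def circ_conv_def balanced_fun_def)
  show "cmod (smoothed_fun N r A n)
      \<le> sqrt (5 / 3) * real_of_int r powr (- 1 / 2) * norm2 N (balanced_fun N A)"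
    using h by (intro cmod_smoothed_fun_le)
  show "sqrt (5 / 3) * real_of_int r powr (- 1 / 2) * norm2 N (balanced_fun N A)
      \<le> sqrt (5 / 12) * real_of_int r powr (- 1 / 2) * real_of_int N powr (1 / 2)"
    using h by (intro norm2_balanced_fun_scaled_le)
next
  show "\<exists>C::real. C > 0 \<and>
      (\<forall>(N::int) (r::int) (A::int set) (n::int).
        2 \<le> N \<longrightarrow> 1 \<le> r \<longrightarrow> r \<le> N div 2 \<longrightarrow>
        A \<subseteq> carrier (residue_ring N) \<longrightarrow> n \<in> carrier (residue_ring N) \<longrightarrow>
          \<bar>(\<Sum>m\<in>carrier (residue_ring N).
              indicator A (n \<ominus>\<^bsub>residue_ring N\<^esub> m) * triangular_kernel N r m)
            - real (card A) / real_of_int N\<bar>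
          \<le> C * real_of_int r powr (- 1 / 2) * real_of_int N powr (1 / 2))"
  proof (intro exI[of _ "sqrt (5 / 12)"] conjI allI impI)
    fix N r :: int and A :: "int set" and n :: int
    assume h: "2 \<le> N" "1 \<le> r" "r \<le> N div 2" "A \<subseteq> carrier (residue_ring N)"
      "n \<in> carrier (residue_ring N)"
    show "\<bar>(\<Sum>m\<in>carrier (residue_ring N).
              indicator A (n \<ominus>\<^bsub>residue_ring N\<^esub> m) * triangular_kernel N r m)
            - real (card A) / real_of_int N\<bar>
          \<le> sqrt (5 / 12) * real_of_int r powr (- 1 / 2) * real_of_int N powr (1 / 2)"
      using order.trans[OF cmod_smoothed_fun_le[OF h(1,2,3,5)]
          norm2_balanced_fun_scaled_le[OF h(1,4)]]
      unfolding smoothed_fun_eq[OF h(1,2,3)] norm_of_real .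
  qed simp
qed

end
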